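(* Let $h\ge 2$, $n=2h$, $m\ge 1$ be integers and $q=\binom m2$. Let $H=\{x_1,\ldots,x_h\}$ be a list of $h$ permutations in $\mathcal{S}_m$, let $\widetilde H=\{\widetilde x_1,\ldots,\widetilde x_h\}$ be its foldover, and let $D=H\cup\widetilde H$ be the corresponding $n$-run foldover order-of-addition (OofA) design for $m$ components. Suppose that $D$ has no repeated run (equivalently, $H$ contains no duplicated run and no pair of foldover runs). Then the following hold. (i) For $1\le i<j\le h$, $k(\widetilde x_i,\widetilde x_j)=k(x_i,x_j)$; for $1\le i\le h$, $k(x_i,\widetilde x_i)=q$; and for $i\ne j$, $k(x_i,\widetilde x_j)=q-k(x_i,x_j)$. Thus all pairwise Kendall tau distances in $D$ are determined by the distance matrix of $H$. (ii) $\displaystyle k_{\mathrm{ave}}(D)=\frac{nm(m-1)}{4(n-1)}.$ (iii) $\displaystyle 1\le k_{\min}(D)\le\left\lfloor\frac{m(m-1)}{4}\right\rfloor.$ (iv) $L_2\le k_{m_2}(D)\le U_2$, where $$L_2=\frac{nm(m-1)(9m^2-5m+10)}{144(n-1)},\qquad U_2=\frac{nm^2(m-1)^2-4(n-2)\{m(m-1)-2\}}{8(n-1)}.$$ The lower bound $L_2$ is attained by OofA-OA$(n,m,2)$ designs whenever such designs exist, i.e. $k_{m_2}(D')=L_2$ for every OofA-OA$(n,m,2)$ design $D'$.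
   Context: Let $\mathcal{Z}_m=\{0,1,\ldots,m-1\}$ and let $\mathcal{S}_m$ be the set of all permutations (orderings) of $\mathcal{Z}_m$. An $n$-run OofA design with $m$ components is a list $D=\{y_1,\ldots,y_n\}$ of $n$ elements of $\mathcal{S}_m$, called runs. The full design $D_{\mathrm{full}}$ consists of all $m!$ elements of $\mathcal{S}_m$, each once. For $x\in\mathcal{S}_m$ and $c\in\mathcal{Z}_m$, $\pi_x(c)$ denotes the position of $c$ in $x$. Kendall tau distance: $k(x,y)=\#\{(a,b):0\le a<b\le m-1,\ (\pi_x(a)-\pi_x(b))(\pi_y(a)-\pi_y(b))<0\}$. For an $n$-run design $D=\{y_1,\ldots,y_n\}$: $k_{\min}(D)=\min_{1\le i<j\le n}k(y_i,y_j)$, $k_{\mathrm{ave}}(D)=\binom{n}{2}^{-1}\sum_{1\le i<j\le n}k(y_i,y_j)$, $k_{m_2}(D)=\binom{n}{2}^{-1}\sum_{1\le i<j\le n}k(y_i,y_j)^2$. Foldover: for $x=(x^{(1)},\ldots,x^{(m)})\in\mathcal{S}_m$, its foldover is the reversed order $\widetilde x=(x^{(m)},\ldots,x^{(1)})$. The design $D=H\cup\widetilde H$ is the list $x_1,\ldots,x_h,\widetilde x_1,\ldots,\widetilde x_h$ of $2h$ runs. "A pair of foldover runs" in $H$ means runs $x_i,x_j$ in $H$ with $x_j=\widetilde x_i$. Pairwise ordering coding: for $0\le a<b\le m-1$, $z_{ab}(x)=+1$ if $\pi_x(a)<\pi_x(b)$ and $z_{ab}(x)=-1$ otherwise. Let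 $\mathcal{Q}=\{(a,b):0\le a<b\le m-1\}$. An $n$-run OofA design $D'$ with $m$ components is an order-of-addition orthogonal array of strength $t$, denoted OofA-OA$(n,m,t)$, if for every $W\subseteq\mathcal{Q}$ with $|W|\le t$ the frequency distribution of the vectors $(z_{ab}(x))_{(a,b)\in W}$ over the runs $x$ of $D'$ (with multiplicity) is proportional to the corresponding frequency distribution over the runs of $D_{\mathrm{full}}$. *)

theory Defs
  imports Complex_Main "HOL-Library.FuncSet" "HOL-Library.Multiset"
    "HOL-Combinatorics.Multiset_Permutations"
begin

type_synonym run = "nat list"

definition runs :: "nat \<Rightarrow> run set" where
  "runs m = permutations_of_set {0..<m}"

text \<open>Positions are counted from 0; only their relative order is ever used.\<close>

definition pos :: "run \<Rightarrow> nat \<Rightarrow> nat" where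
  "pos x c = (THE i. i < length x \<and> x ! i = c)"

definition comp_pairs :: "nat \<Rightarrow> (nat \<times> nat) set" where
  "comp_pairs m = {(a, b). a < b \<and> b < m}"

definition kendall_tau :: "nat \<Rightarrow> run \<Rightarrow> run \<Rightarrow> nat" where
  "kendall_tau m x y = card {(a, b) \<in> comp_pairs m.
     (int (pos x a) - int (pos x b)) * (int (pos y a) - int (pos y b)) < 0}"

text \<open>
  A design is a list of runs, so repeated runs are allowed. The three summaries below
  are meaningful for designs with at least two runs.
\<close>

definition index_pairs :: "run list \<Rightarrow> (nat \<times> nat) set" where
  "index_pairs D = {(i, j). i < j \<and> j < length D}"

definition k_min :: "nat \<Rightarrow> run list \<Rightarrow> nat" where
  "k_min m D = Min ((\<lambda>(i, j). kendall_tau m (D ! i) (D ! j)) ` index_pairs D)"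

definition k_ave :: "nat \<Rightarrow> run list \<Rightarrow> real" where
  "k_ave m D = (\<Sum>(i, j)\<in>index_pairs D. real (kendall_tau m (D ! i) (D ! j)))
     / real (length D choose 2)"

definition k_m2 :: "nat \<Rightarrow> run list \<Rightarrow> real" where
  "k_m2 m D = (\<Sum>(i, j)\<in>index_pairs D. (real (kendall_tau m (D ! i) (D ! j)))\<^sup>2)
     / real (length D choose 2)"

definition foldover :: "run \<Rightarrow> run" where
  "foldover x = rev x"

definition foldover_design :: "run list \<Rightarrow> run list" where
  "foldover_design H = H @ map foldover H"

definition pwo :: "run \<Rightarrow> nat \<times> nat \<Rightarrow> int" where
  "pwo x = (\<lambda>(a, b). if pos x a < pos x b then 1 else - 1)"

text \<open>
  The vector of pairwise ordering codes indexed by \<open>W\<close> is a function restricted to \<open>W\<close>;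
  frequencies are taken over a multiset of runs.
\<close>

definition pwo_freq :: "(nat \<times> nat) set \<Rightarrow> run multiset \<Rightarrow> (nat \<times> nat \<Rightarrow> int) \<Rightarrow> nat" where
  "pwo_freq W M v = count (image_mset (\<lambda>x. restrict (pwo x) W) M) v"

definition full_design :: "nat \<Rightarrow> run multiset" where
  "full_design m = mset_set (runs m)"

definition oofa_oa :: "nat \<Rightarrow> nat \<Rightarrow> nat \<Rightarrow> run list \<Rightarrow> bool" where
  "oofa_oa n m t D \<longleftrightarrow> length D = n \<and> set D \<subseteq> runs m \<and>
     (\<forall>W \<subseteq> comp_pairs m. card W \<le> t \<longrightarrow>
        (\<exists>c::real. c > 0 \<and>
           (\<forall>v. real (pwo_freq W (mset D) v) = c * real (pwo_freq W (full_design m) v))))"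

definition L2 :: "nat \<Rightarrow> nat \<Rightarrow> real" where
  "L2 n m = real n * real m * (real m - 1) * (9 * (real m)\<^sup>2 - 5 * real m + 10)
     / (144 * (real n - 1))"

definition U2 :: "nat \<Rightarrow> nat \<Rightarrow> real" where
  "U2 n m = (real n * (real m)\<^sup>2 * (real m - 1)\<^sup>2
       - 4 * (real n - 2) * (real m * (real m - 1) - 2))
     / (8 * (real n - 1))"

end

theory Submission
  imports Defs
begin

text \<open>
  Code a run \<open>x\<close> by its antisymmetric precedence signs \<open>z\<^sub>a\<^sub>b(x)\<close>. The Kendall distance is then
  an affine function of an inner product: \<open>\<Sum>\<^sub>a\<^sub>b z\<^sub>a\<^sub>b(x) z\<^sub>a\<^sub>b(y) = m(m-1) - 4 k(x,y)\<close>.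
  Reversal negates \<open>z\<close>, so all first moments of a foldover design vanish; this gives (i) and (ii).

  Exchanging summations turns the sum of the squared inner products over \<open>D\<close> into the sum of
  the squared second moments \<open>T = \<Sum>\<^sub>i z\<^sub>a\<^sub>b(y\<^sub>i) z\<^sub>c\<^sub>d(y\<^sub>i)\<close>.
  Let \<open>\<rho>\<close> be the normalized second moments of the full design. Then \<open>\<Sum> \<rho> z\<^sub>a\<^sub>b(x) z\<^sub>c\<^sub>d(x)\<close> is the
  same constant for every run \<open>x\<close>, because the scores \<open>\<Sum>\<^sub>b z\<^sub>a\<^sub>b(x)\<close> always run through
  \<open>m-1, m-3, \<dots>, 1-m\<close>. Hence \<open>0 \<le> \<Sum> (T - n\<rho>)\<^sup>2\<close> is the lower bound in (iv), with
  equality for \<open>T = n\<rho>\<close>, i.e. for arrays of strength 2. The upper bound sums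
  \<open>k\<^sup>2 + (q-k)\<^sup>2 \<le> 1 + (q-1)\<^sup>2\<close>, valid for \<open>1 \<le> k \<le> q-1\<close>.
\<close>

subsection \<open>Runs and precedence signs\<close>

lemma runs_iff: "x \<in> runs m \<longleftrightarrow> distinct x \<and> set x = {..<m}"
  by (auto simp: runs_def permutations_of_set_def lessThan_atLeast0)

lemma length_run: "x \<in> runs m \<Longrightarrow> length x = m"
  by (metis runs_iff distinct_card card_lessThan)

lemma pos_nth: "distinct x \<Longrightarrow> i < length x \<Longrightarrow> pos x (x ! i) = i"
  unfolding pos_def by (rule the_equality) (auto simp: nth_eq_iff_index_eq)

lemma pos_run:
  assumes "x \<in> runs m" "c < m"
  shows "pos x c < m" "x ! pos x c = c"
proof -
  have "c \<in> set x" using assms by (simp add: runs_iff)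
  then obtain i where "i < length x" "x ! i = c" by (auto simp: in_set_conv_nth)
  then show "pos x c < m" "x ! pos x c = c"
    using assms(1) pos_nth[of x i] length_run[OF assms(1)] by (auto simp: runs_iff)
qed

lemma nth_run: "x \<in> runs m \<Longrightarrow> i < m \<Longrightarrow> x ! i < m"
  using nth_mem[of i x] length_run[of x m] by (simp add: runs_iff)

lemma pos_eqI:
  assumes "x \<in> runs m" "i < m" "x ! i = c"
  shows "pos x c = i"
  using assms pos_nth[of x i] length_run[of x m] by (auto simp: runs_iff)

lemma pos_eq_iff:
  assumes "x \<in> runs m" "a < m" "b < m"
  shows "pos x a = pos x b \<longleftrightarrow> a = b"
  using pos_run(2)[OF assms(1)] assms(2,3) by metis

lemma bij_betw_pos: "x \<in> runs m \<Longrightarrow> bij_betw (pos x) {..<m} {..<m}"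
  by (rule bij_betwI[where g = "(!) x"])
    (use nth_run in \<open>simp_all add: pos_run pos_eqI\<close>)

lemma run_eqI:
  assumes "x \<in> runs m" "y \<in> runs m" "\<And>c. c < m \<Longrightarrow> pos x c = pos y c"
  shows "x = y"
proof (rule nth_equalityI)
  show "length x = length y" using assms by (simp add: length_run)
  fix i assume "i < length x"
  then have i: "i < m" using assms by (simp add: length_run)
  then have "x ! i < m" using assms(1) by (simp add: nth_run)
  then show "x ! i = y ! i"
    using assms pos_run(2)[of y m "x ! i"] pos_eqI[OF assms(1) i refl] by simp
qed

lemma foldover_run: "foldover x \<in> runs m \<longleftrightarrow> x \<in> runs m"
  by (simp add: runs_iff foldover_def)

lemma pos_foldover:
  assumes "x \<in> runs m" "c < m"
  shows "pos (foldover x) c = m - 1 - pos x c"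
  using assms pos_run[OF assms] length_run[OF assms(1)]
  by (intro pos_eqI[of _ m]) (simp_all add: foldover_run, simp add: foldover_def rev_nth)

lemma map_permutes_run: "\<sigma> permutes {..<m} \<Longrightarrow> x \<in> runs m \<Longrightarrow> map \<sigma> x \<in> runs m"
  by (auto simp: runs_iff distinct_map permutes_image permutes_inj_on)

lemma pos_map_permutes:
  assumes "\<sigma> permutes {..<m}" "x \<in> runs m" "c < m"
  shows "pos (map \<sigma> x) (\<sigma> c) = pos x c"
  using assms pos_run[OF assms(2,3)] length_run[OF assms(2)]
  by (intro pos_eqI[of _ m]) (auto intro: map_permutes_run)

text \<open>A real-valued, antisymmetric variant of \<open>pwo\<close>, defined for every ordered
  pair and zero on the diagonal. Sums can then range over the full square of components, which is
  stable under relabelling.\<close>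

definition prec_sgn :: "run \<Rightarrow> nat \<Rightarrow> nat \<Rightarrow> real" where
  "prec_sgn x a b = sgn (real (pos x b) - real (pos x a))"

lemma prec_sgn_refl [simp]: "prec_sgn x a a = 0"
  by (simp add: prec_sgn_def)

lemma prec_sgn_swap: "prec_sgn x b a = - prec_sgn x a b"
  by (simp add: prec_sgn_def sgn_if)

lemma prec_sgn_sq:
  assumes "x \<in> runs m" "a < m" "b < m"
  shows "prec_sgn x a b * prec_sgn x a b = of_bool (a \<noteq> b)"
  using pos_eq_iff[OF assms] by (auto simp: prec_sgn_def sgn_if)

lemma prec_sgn_pwo:
  assumes "x \<in> runs m" "a < m" "b < m" "a \<noteq> b"
  shows "prec_sgn x a b = of_int (pwo x (a, b))"
  using pos_eq_iff[OF assms(1-3)] assms(4) by (auto simp: prec_sgn_def sgn_if pwo_def)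

lemma prec_sgn_foldover:
  assumes "x \<in> runs m" "a < m" "b < m"
  shows "prec_sgn (foldover x) a b = - prec_sgn x a b"
  using pos_run(1)[OF assms(1,2)] pos_run(1)[OF assms(1,3)]
  by (auto simp: prec_sgn_def pos_foldover[OF assms(1,2)] pos_foldover[OF assms(1,3)] sgn_if)

text \<open>Among three distinct components exactly one is in the middle, and its summand is \<open>-1\<close>.\<close>

lemma prec_sgn_triple:
  assumes "x \<in> runs m" "a < m" "b < m" "c < m" "a \<noteq> b" "a \<noteq> c" "b \<noteq> c"
  shows "prec_sgn x a b * prec_sgn x a c + prec_sgn x b a * prec_sgn x b c
    + prec_sgn x c a * prec_sgn x c b = 1"
proof -
  have sgn: "prec_sgn x u v = (if pos x u < pos x v then 1 else - 1)"
    if "u < m" "v < m" "u \<noteq> v" for u v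
    using pos_eq_iff[OF assms(1) that(1,2)] that(3) by (auto simp: prec_sgn_def sgn_if)
  show ?thesis
    using assms pos_eq_iff[of x m a b] pos_eq_iff[of x m a c] pos_eq_iff[of x m b c]
    by (simp add: sgn)
qed

section \<open>Kendall distance as an inner product of sign vectors\<close>

definition pair_ip :: "nat \<Rightarrow> run \<Rightarrow> run \<Rightarrow> real" where
  "pair_ip m x y = (\<Sum>a<m. \<Sum>b<m. prec_sgn x a b * prec_sgn y a b)"

lemma finite_comp_pairs [simp]: "finite (comp_pairs m)"
  by (rule finite_subset[of _ "{..<m} \<times> {..<m}"]) (auto simp: comp_pairs_def)

text \<open>Serves for pairs of components as well as, with \<open>length D\<close> in place of
  \<open>m\<close>, for pairs of run indices; the constant summand 1 yields the number of
  pairs.\<close>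

lemma sum_pairs_symmetric:
  fixes f :: "nat \<Rightarrow> nat \<Rightarrow> 'a::comm_ring_1"
  assumes "\<And>a b. f a b = f b a"
  shows "(\<Sum>a<m. \<Sum>b<m. f a b) = 2 * (\<Sum>(a, b)\<in>comp_pairs m. f a b) + (\<Sum>a<m. f a a)"
proof (induction m)
  case 0
  show ?case by (simp add: comp_pairs_def)
next
  case (Suc m)
  have "comp_pairs (Suc m) = comp_pairs m \<union> (\<lambda>a. (a, m)) ` {..<m}"
    by (auto simp: comp_pairs_def)
  moreover have "comp_pairs m \<inter> (\<lambda>a. (a, m)) ` {..<m} = {}"
    by (auto simp: comp_pairs_def)
  ultimately have "(\<Sum>(a, b)\<in>comp_pairs (Suc m). f a b)
      = (\<Sum>(a, b)\<in>comp_pairs m. f a b) + (\<Sum>a<m. f a m)"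
    by (simp add: sum.union_disjoint sum.reindex inj_on_def)
  moreover have "(\<Sum>b<m. f m b) = (\<Sum>a<m. f a m)"
    by (intro sum.cong refl assms)
  ultimately show ?case
    using Suc.IH by (simp add: sum.distrib algebra_simps)
qed

lemma card_comp_pairs: "card (comp_pairs m) = m choose 2"
proof -
  have "int m * int m = 2 * int (card (comp_pairs m)) + int m"
    using sum_pairs_symmetric[of "\<lambda>_ _. 1 :: int" m] by simp
  then have "m * m = 2 * card (comp_pairs m) + m"
    by (simp flip: of_nat_mult of_nat_add)
  then have "m * (m - 1) = 2 * card (comp_pairs m)"
    by (simp add: algebra_simps)
  then show ?thesis
    by (simp add: choose_two)
qed

lemma real_choose_two: "real (n choose 2) = real n * (real n - 1) / 2"
  by (cases n) (auto simp: choose_two real_of_nat_div algebra_simps)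

lemma kendall_tau_conv:
  "kendall_tau m x y
    = card {(a, b) \<in> comp_pairs m. prec_sgn x a b * prec_sgn y a b < 0}"
proof -
  have "(int (pos x a) - int (pos x b)) * (int (pos y a) - int (pos y b)) < 0
    \<longleftrightarrow> prec_sgn x a b * prec_sgn y a b < 0" for a b
    by (auto simp: prec_sgn_def sgn_if mult_less_0_iff)
  then show ?thesis by (simp add: kendall_tau_def)
qed

text \<open>Among the q = \<open>m choose 2\<close> pairs, a concordant one contributes 1 and a
  discordant one -1, giving q - 2k; the full square counts every pair twice.\<close>

lemma pair_ip_kendall_tau:
  assumes "x \<in> runs m" "y \<in> runs m"
  shows "pair_ip m x y = real m * (real m - 1) - 4 * real (kendall_tau m x y)"
proof -
  let ?f = "\<lambda>a b. prec_sgn x a b * prec_sgn y a b"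
  let ?N = "{(a, b) \<in> comp_pairs m. ?f a b < 0}"
  have "pair_ip m x y = 2 * (\<Sum>(a, b)\<in>comp_pairs m. ?f a b)"
    unfolding pair_ip_def
    by (subst sum_pairs_symmetric) (metis prec_sgn_swap minus_mult_minus, simp)
  also have "(\<Sum>(a, b)\<in>comp_pairs m. ?f a b)
      = (\<Sum>p\<in>comp_pairs m. 1 - 2 * of_bool (p \<in> ?N))"
  proof (intro sum.cong refl)
    fix p assume "p \<in> comp_pairs m"
    then obtain a b where p: "p = (a, b)" "a < m" "b < m" "a \<noteq> b"
      by (auto simp: comp_pairs_def)
    show "(case p of (a, b) \<Rightarrow> ?f a b) = 1 - 2 * of_bool (p \<in> ?N)"
      using \<open>p \<in> comp_pairs m\<close> pos_eq_iff[OF assms(1) p(2,3)] pos_eq_iff[OF assms(2) p(2,3)] p(4)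
      unfolding p by (auto simp: prec_sgn_def sgn_if)
  qed
  also have "\<dots> = real (card (comp_pairs m)) - 2 * real (card ?N)"
    by (simp add: sum_subtractf flip: sum_distrib_left)
      (auto simp: of_bool_def sum.If_cases intro!: arg_cong[where f = card])
  finally show ?thesis
    by (simp add: kendall_tau_conv card_comp_pairs real_choose_two)
qed

lemma kendall_tau_commute: "kendall_tau m x y = kendall_tau m y x"
  by (simp add: kendall_tau_def mult.commute)

lemma kendall_tau_self: "kendall_tau m x x = 0"
  by (auto simp: kendall_tau_def not_less)

text \<open>Reversing \<open>y\<close> negates all its signs, hence the inner product. The identity
  is stated in the reals to avoid truncated subtraction.\<close>

lemma kendall_tau_foldover:
  assumes "x \<in> runs m" "y \<in> runs m"
  shows "real (kendall_tau m x (foldover y)) = real (m choose 2) - real (kendall_tau m x y)"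
proof -
  have "pair_ip m x (foldover y) = - pair_ip m x y"
    by (simp add: pair_ip_def prec_sgn_foldover[OF assms(2)] sum_negf)
  then show ?thesis
    using assms by (simp add: pair_ip_kendall_tau foldover_run real_choose_two)
qed

lemma kendall_tau_foldover_both:
  assumes "x \<in> runs m" "y \<in> runs m"
  shows "kendall_tau m (foldover x) (foldover y) = kendall_tau m x y"
  using kendall_tau_foldover[of y m x] kendall_tau_foldover[of "foldover x" m y] assms
  by (simp add: kendall_tau_commute foldover_run)

section \<open>Scores of the components in a run\<close>

lemma sum_sgn_diff:
  "(\<Sum>i<m. sgn (real i - real p)) = (if m \<le> p then - real m else real m - 1 - 2 * real p)"
  \<comment> \<open>The branch \<open>m \<le> p\<close> carries the induction through ranges that
    have not yet reached \<open>p\<close>.\<close>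
  by (induction m) (auto simp: sgn_if)

text \<open>The score of \<open>a\<close> is the number of components after it minus the number
  before it, so it determines the position of \<open>a\<close>.\<close>

lemma sum_prec_sgn:
  assumes "x \<in> runs m" "a < m"
  shows "(\<Sum>b<m. prec_sgn x a b) = real m - 1 - 2 * real (pos x a)"
  using sum.reindex_bij_betw[OF bij_betw_pos[OF assms(1)], of "\<lambda>i. sgn (real i - real (pos x a))"]
    pos_run(1)[OF assms]
  by (simp add: prec_sgn_def sum_sgn_diff)

lemma sum_sq_prec_sgn:
  assumes "x \<in> runs m"
  shows "(\<Sum>a<m. (\<Sum>b<m. prec_sgn x a b)\<^sup>2) = real m * ((real m)\<^sup>2 - 1) / 3"
proof -
  \<comment> \<open>Here \<open>c\<close> is decoupled from the range \<open>k\<close>: in the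
    intended instance \<open>m\<close> occurs in both, and induction on \<open>m\<close> would alter
    the summand.\<close>
  have aux: "(\<Sum>i<k. (c - 2 * real i)\<^sup>2)
      = real k * c\<^sup>2 - 2 * c * real k * (real k - 1) + 2 * real k * (real k - 1) * (2 * real k - 1) / 3"
    for k and c :: real
    by (induction k)
      (simp_all add: algebra_simps power2_eq_square add_divide_distrib diff_divide_distrib)
  have "(\<Sum>a<m. (\<Sum>b<m. prec_sgn x a b)\<^sup>2) = (\<Sum>a<m. (real m - 1 - 2 * real (pos x a))\<^sup>2)"
    using assms by (simp add: sum_prec_sgn)
  also have "\<dots> = (\<Sum>i<m. (real m - 1 - 2 * real i)\<^sup>2)"
    by (rule sum.reindex_bij_betw[OF bij_betw_pos[OF assms]])
  finally show ?thesis
    unfolding aux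
    by (simp add: algebra_simps power2_eq_square add_divide_distrib diff_divide_distrib)
qed

text \<open>Without discordant pairs all signs agree, hence all scores, hence all positions.\<close>

lemma kendall_tau_eq_0D:
  assumes "x \<in> runs m" "y \<in> runs m" "kendall_tau m x y = 0"
  shows "x = y"
proof (rule run_eqI[OF assms(1,2)])
  fix c assume c: "c < m"
  have eq: "prec_sgn x a b = prec_sgn y a b" if "a < b" "b < m" for a b
  proof -
    have "finite {(a, b) \<in> comp_pairs m. prec_sgn x a b * prec_sgn y a b < 0}"
      by (rule finite_subset[of _ "comp_pairs m"]) auto
    then have "{(a, b) \<in> comp_pairs m. prec_sgn x a b * prec_sgn y a b < 0} = {}"
      using assms(3) unfolding kendall_tau_conv by simp
    then have "\<not> prec_sgn x a b * prec_sgn y a b < 0"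
      using that by (auto simp: comp_pairs_def)
    then show ?thesis
      using that pos_eq_iff[OF assms(1), of a b] pos_eq_iff[OF assms(2), of a b]
      by (auto simp: prec_sgn_def sgn_if split: if_splits)
  qed
  have "prec_sgn x c b = prec_sgn y c b" if "b < m" for b
    using eq[of b c] eq[of c b] that c prec_sgn_swap[of x b c] prec_sgn_swap[of y b c]
    by (cases b c rule: linorder_cases) simp_all
  then show "pos x c = pos y c"
    using sum_prec_sgn[OF assms(1) c] sum_prec_sgn[OF assms(2) c] by simp
qed

subsection \<open>Moments of the full design\<close>

lemma finite_runs [simp]: "finite (runs m)"
  by (simp add: runs_def)

text \<open>Relabelling the components permutes the full design. This symmetry yields all its
  moments.\<close>

lemma sum_runs_relabel:
  assumes "\<sigma> permutes {..<m}"
  shows "(\<Sum>x\<in>runs m. g (map \<sigma> x)) = (\<Sum>x\<in>runs m. g x)"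
proof (rule sum.reindex_bij_betw)
  have "inj_on (map \<sigma>) (runs m)"
    using permutes_inj[OF assms] by (auto intro: inj_on_subset)
  moreover have "map \<sigma> ` runs m \<subseteq> runs m"
    using map_permutes_run[OF assms] by blast
  ultimately show "bij_betw (map \<sigma>) (runs m) (runs m)"
    by (simp add: bij_betw_def endo_inj_surj)
qed

lemma prec_sgn_map_permutes:
  assumes "\<sigma> permutes {..<m}" "x \<in> runs m" "a < m" "b < m"
  shows "prec_sgn (map \<sigma> x) (\<sigma> a) (\<sigma> b) = prec_sgn x a b"
  using assms by (simp add: prec_sgn_def pos_map_permutes)

definition full_moment :: "nat \<Rightarrow> nat \<Rightarrow> nat \<Rightarrow> nat \<Rightarrow> nat \<Rightarrow> real" where
  "full_moment m a b c d = (\<Sum>x\<in>runs m. prec_sgn x a b * prec_sgn x c d)"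

lemma full_moment_permutes:
  assumes "\<sigma> permutes {..<m}" "a < m" "b < m" "c < m" "d < m"
  shows "full_moment m (\<sigma> a) (\<sigma> b) (\<sigma> c) (\<sigma> d) = full_moment m a b c d"
  unfolding full_moment_def
  by (subst sum_runs_relabel[OF assms(1), symmetric])
    (simp add: prec_sgn_map_permutes[OF assms(1)] assms(2-))

lemma full_moment_swap:
  "full_moment m b a c d = - full_moment m a b c d"
  "full_moment m a b d c = - full_moment m a b c d"
  by (simp_all add: full_moment_def prec_sgn_swap[of _ b a] prec_sgn_swap[of _ d c] sum_negf)

lemma transpose_permutes: "a < m \<Longrightarrow> b < m \<Longrightarrow> transpose a b permutes {..<m}"
  by (simp add: permutes_swap_id)

text \<open>Exchanging the labels \<open>a\<close> and \<open>b\<close> turns the sum into its own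
  negative.\<close>

lemma sum_prec_sgn_full:
  assumes "a < m" "b < m"
  shows "(\<Sum>x\<in>runs m. prec_sgn x a b) = 0"
proof -
  have "(\<Sum>x\<in>runs m. prec_sgn x b a)
      = (\<Sum>x\<in>runs m. prec_sgn (map (transpose a b) x) b a)"
    by (rule sum_runs_relabel[OF transpose_permutes[OF assms], symmetric])
  also have "\<dots> = (\<Sum>x\<in>runs m. prec_sgn x a b)"
    using prec_sgn_map_permutes[OF transpose_permutes[OF assms] _ assms] by simp
  finally show ?thesis
    by (simp add: prec_sgn_swap[of _ b a] sum_negf)
qed

text \<open>The transposition of \<open>a\<close> and \<open>b\<close> fixes \<open>c\<close> and
  \<open>d\<close>, so the moment equals its own negative.\<close>

lemma full_moment_disjoint:
  assumes "a < m" "b < m" "c < m" "d < m" "c \<notin> {a, b}" "d \<notin> {a, b}"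
  shows "full_moment m a b c d = 0"
  using full_moment_permutes[OF transpose_permutes[OF assms(1,2)] assms(1-4)] assms(5,6)
    full_moment_swap(1)[of m b a c d]
  by (simp add: transpose_def)

text \<open>By symmetry the moment is the same whichever of the three components is shared, and by
  \<open>prec_sgn_triple\<close> the three moments add up to the number of runs.\<close>

lemma full_moment_triple:
  assumes "a < m" "b < m" "c < m" "a \<noteq> b" "a \<noteq> c" "b \<noteq> c"
  shows "full_moment m a b a c = real (card (runs m)) / 3"
proof -
  have "full_moment m b a b c = full_moment m a b a c"
    using full_moment_permutes[OF transpose_permutes[OF assms(1,2)] assms(1,2,1,3)] assms(4-)
    by (simp add: transpose_def)
  moreover have "full_moment m c b c a = full_moment m a b a c"
    using full_moment_permutes[OF transpose_permutes[OF assms(1,3)] assms(1,2,1,3)] assms(4-)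
    by (simp add: transpose_def)
  moreover have "full_moment m c b c a = full_moment m c a c b"
    by (simp add: full_moment_def mult.commute)
  moreover have "full_moment m a b a c + full_moment m b a b c + full_moment m c a c b
      = real (card (runs m))"
    unfolding full_moment_def by (simp add: prec_sgn_triple[OF _ assms] flip: sum.distrib)
  ultimately show ?thesis by simp
qed

text \<open>
  The normalized second moments of the full design. The last two summands raise the value
  from \<open>2/3\<close> to \<open>1\<close> on equal pairs, and from \<open>-2/3\<close> to \<open>-1\<close> on reversed ones.
\<close>

definition oa_corr :: "nat \<Rightarrow> nat \<Rightarrow> nat \<Rightarrow> nat \<Rightarrow> real" where
  "oa_corr a b c d = (of_bool (a = c) - of_bool (a = d) - of_bool (b = c) + of_bool (b = d)
     + of_bool (a = c) * of_bool (b = d) - of_bool (a = d) * of_bool (b = c)) / 3"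

lemma oa_corr_swap:
  "oa_corr b a c d = - oa_corr a b c d"
  "oa_corr a b d c = - oa_corr a b c d"
  unfolding oa_corr_def minus_divide_left by (rule arg_cong2[where f = "(/)"]; argo)+

lemma oa_corr_degenerate: "a = b \<or> c = d \<Longrightarrow> oa_corr a b c d = 0"
  unfolding oa_corr_def by (elim disjE) (hypsubst, argo)+

lemma full_moment_eq:
  assumes "a < m" "b < m" "c < m" "d < m"
  shows "full_moment m a b c d = real (card (runs m)) * oa_corr a b c d"
proof (cases "a = b \<or> c = d")
  case True
  then show ?thesis by (auto simp: full_moment_def oa_corr_degenerate)
next
  case False
  \<comment> \<open>A shared first component gives correlation 1 if \<open>v = w\<close> and 1/3
    otherwise. Antisymmetry reduces the other positions of a shared component to this one.\<close>
  have shared: "full_moment m u v u w = real (card (runs m)) * oa_corr u v u w"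
    if "u < m" "v < m" "w < m" "u \<noteq> v" "u \<noteq> w" for u v w
  proof (cases "v = w")
    case True
    have "full_moment m u v u v = (\<Sum>x\<in>runs m. 1)"
      unfolding full_moment_def using that by (intro sum.cong) (auto simp: prec_sgn_sq)
    then show ?thesis using True that by (simp add: oa_corr_def)
  next
    case False
    then show ?thesis using that by (auto simp: full_moment_triple oa_corr_def)
  qed
  consider "a = c" | "a = d" | "b = c" | "b = d" | "c \<notin> {a, b}" "d \<notin> {a, b}" by auto
  then show ?thesis
  proof cases
    case 1
    then show ?thesis using shared[of a b d] assms False by simp
  next
    case 2
    show ?thesis
      unfolding 2[symmetric] full_moment_swap(2)[of m a b c a] oa_corr_swap(2)[of a b c a]
      using shared[of a b c] assms False 2 by simp
  next
    case 3
    show ?thesis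
      unfolding 3[symmetric] full_moment_swap(1)[of m a b b d] oa_corr_swap(1)[of a b b d]
      using shared[of b a d] assms False 3 by simp
  next
    case 4
    show ?thesis
      unfolding 4[symmetric] full_moment_swap(1)[of m a b c b] oa_corr_swap(1)[of a b c b]
        full_moment_swap(2)[of m b a c b] oa_corr_swap(2)[of b a c b]
      using shared[of b a c] assms False 4 by simp
  next
    case 5
    then show ?thesis using assms False by (auto simp: full_moment_disjoint oa_corr_def)
  qed
qed

text \<open>The contraction of \<open>oa_corr\<close> with the sign products of any single run, and
  also the sum of the squares of \<open>oa_corr\<close>.\<close>

definition oa_const :: "nat \<Rightarrow> real" where
  "oa_const m = 2 * real m * (real m - 1) * (2 * real m + 5) / 9"

text \<open>Contracting \<open>oa_corr\<close> with the signs once leaves 2(R a - R b + z)/3, with R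
  the scores and z the sign of (a, b). The second contraction leaves 4/3 of the sum of squared
  scores plus 2/3 of m(m-1), and neither depends on the run.\<close>

lemma sum_oa_corr_run:
  assumes "x \<in> runs m"
  shows "(\<Sum>a<m. \<Sum>b<m. \<Sum>c<m. \<Sum>d<m. oa_corr a b c d * (prec_sgn x a b * prec_sgn x c d))
    = oa_const m"
proof -
  define R where "R a = (\<Sum>b<m. prec_sgn x a b)" for a
  have R': "(\<Sum>b<m. prec_sgn x b a) = - R a" for a
    unfolding R_def sum_negf[symmetric] by (intro sum.cong refl prec_sgn_swap)
  have inner: "(\<Sum>c<m. \<Sum>d<m. oa_corr a b c d * prec_sgn x c d)
      = (2 * R a - 2 * R b + 2 * prec_sgn x a b) / 3" if "a < m" "b < m" for a b
  proof -
    have row: "(\<Sum>c<m. \<Sum>d<m. of_bool (u = c) * prec_sgn x c d) = R u" if "u < m" for u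
    proof -
      have "(\<Sum>c<m. \<Sum>d<m. of_bool (u = c) * prec_sgn x c d) = (\<Sum>c<m. if c = u then R u else 0)"
        by (intro sum.cong) (auto simp: R_def)
      then show ?thesis using that by simp
    qed
    have col: "(\<Sum>c<m. \<Sum>d<m. of_bool (u = d) * prec_sgn x c d) = - R u" if "u < m" for u
      using row[OF that] by (subst sum.swap) (subst prec_sgn_swap, simp add: sum_negf)
    have cell: "(\<Sum>c<m. \<Sum>d<m. of_bool (u = c) * of_bool (v = d) * prec_sgn x c d)
        = prec_sgn x u v" if "u < m" "v < m" for u v
      using that by (simp add: mult.assoc flip: sum_distrib_left)
    \<comment> \<open>Each summand is a Kronecker delta or a product of two, contracting to a row
      sum, a column sum or a single sign. The factors of the last product are exchanged to fit
      \<open>cell\<close>.\<close>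
    have "oa_corr a b c d * prec_sgn x c d
        = (of_bool (a = c) * prec_sgn x c d - of_bool (a = d) * prec_sgn x c d
          - of_bool (b = c) * prec_sgn x c d + of_bool (b = d) * prec_sgn x c d
          + of_bool (a = c) * of_bool (b = d) * prec_sgn x c d
          - of_bool (b = c) * of_bool (a = d) * prec_sgn x c d) / 3" for c d
      by (simp add: oa_corr_def algebra_simps)
    then have "(\<Sum>c<m. \<Sum>d<m. oa_corr a b c d * prec_sgn x c d)
        = (R a + R a - R b - R b + prec_sgn x a b - prec_sgn x b a) / 3"
      by (simp only: sum_divide_distrib[symmetric] sum.distrib sum_subtractf row col cell that)
        simp
    then show ?thesis by (simp add: prec_sgn_swap[of _ b a])
  qed
  have "(\<Sum>a<m. \<Sum>b<m. \<Sum>c<m. \<Sum>d<m. oa_corr a b c d * (prec_sgn x a b * prec_sgn x c d))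
      = (\<Sum>a<m. \<Sum>b<m. prec_sgn x a b * (\<Sum>c<m. \<Sum>d<m. oa_corr a b c d * prec_sgn x c d))"
    by (simp add: sum_distrib_left mult_ac)
  also have "\<dots> = (\<Sum>a<m. \<Sum>b<m. 2 / 3 * (R a * prec_sgn x a b) - 2 / 3 * (R b * prec_sgn x a b)
        + 2 / 3 * (prec_sgn x a b * prec_sgn x a b))"
    by (intro sum.cong refl) (subst inner, simp_all add: field_simps)
  also have "\<dots> = 2 / 3 * (\<Sum>a<m. \<Sum>b<m. R a * prec_sgn x a b)
      - 2 / 3 * (\<Sum>a<m. \<Sum>b<m. R b * prec_sgn x a b)
      + 2 / 3 * (\<Sum>a<m. \<Sum>b<m. prec_sgn x a b * prec_sgn x a b)"
    by (simp only: sum.distrib sum_subtractf sum_distrib_left)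
  also have "(\<Sum>a<m. \<Sum>b<m. R a * prec_sgn x a b) = (\<Sum>a<m. (R a)\<^sup>2)"
    by (simp add: R_def power2_eq_square flip: sum_distrib_left)
  also have "(\<Sum>a<m. \<Sum>b<m. R b * prec_sgn x a b) = - (\<Sum>a<m. (R a)\<^sup>2)"
    by (subst sum.swap) (simp add: R' power2_eq_square sum_negf flip: sum_distrib_left)
  also have "(\<Sum>a<m. (R a)\<^sup>2) = real m * ((real m)\<^sup>2 - 1) / 3"
    unfolding R_def by (rule sum_sq_prec_sgn[OF assms])
  also have "(\<Sum>a<m. \<Sum>b<m. prec_sgn x a b * prec_sgn x a b) = real m * (real m - 1)"
  proof -
    have "(\<Sum>a<m. \<Sum>b<m. prec_sgn x a b * prec_sgn x a b) = pair_ip m x x"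
      by (simp add: pair_ip_def)
    then show ?thesis by (simp add: pair_ip_kendall_tau assms kendall_tau_self)
  qed
  finally show ?thesis
    by (simp add: oa_const_def algebra_simps power2_eq_square add_divide_distrib diff_divide_distrib)
qed

lemma card_runs_pos: "card (runs m) > 0"
  by (simp add: runs_def)

text \<open>
  Summing the constant value from \<open>sum_oa_corr_run\<close> over the full design evaluates the sum of squares
  without expanding it.
\<close>

lemma sum_oa_corr_sq:
  "(\<Sum>a<m. \<Sum>b<m. \<Sum>c<m. \<Sum>d<m. (oa_corr a b c d)\<^sup>2) = oa_const m"
proof -
  let ?N = "real (card (runs m))"
  have "?N * oa_const m = (\<Sum>x\<in>runs m. \<Sum>a<m. \<Sum>b<m. \<Sum>c<m. \<Sum>d<m.
      oa_corr a b c d * (prec_sgn x a b * prec_sgn x c d))"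
    by (simp add: sum_oa_corr_run)
  also have "\<dots> = (\<Sum>a<m. \<Sum>b<m. \<Sum>c<m. \<Sum>d<m. oa_corr a b c d * full_moment m a b c d)"
    unfolding full_moment_def sum_distrib_left by (simp only: sum.swap[of _ _ "runs m"])
  also have "\<dots> = ?N * (\<Sum>a<m. \<Sum>b<m. \<Sum>c<m. \<Sum>d<m. (oa_corr a b c d)\<^sup>2)"
    by (simp add: full_moment_eq sum_distrib_left power2_eq_square mult_ac)
  finally show ?thesis using card_runs_pos[of m] by auto
qed

subsection \<open>Moments of a design\<close>

text \<open>For the matrix W with entries \<open>w i p\<close>, both sides are the squared Frobenius
  norm of a Gram matrix: W W^T on the left, W^T W on the right.\<close>

lemma sum_gram_sq:
  fixes w :: "'i \<Rightarrow> 'p \<Rightarrow> 'a::comm_semiring_1"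
  shows "(\<Sum>i\<in>I. \<Sum>j\<in>I. (\<Sum>p\<in>P. w i p * w j p)\<^sup>2)
    = (\<Sum>p\<in>P. \<Sum>r\<in>P. (\<Sum>i\<in>I. w i p * w i r)\<^sup>2)"
proof -
  have "(\<Sum>i\<in>I. \<Sum>j\<in>I. (\<Sum>p\<in>P. w i p * w j p)\<^sup>2)
      = (\<Sum>i\<in>I. \<Sum>j\<in>I. \<Sum>p\<in>P. \<Sum>r\<in>P. (w i p * w i r) * (w j p * w j r))"
    by (simp add: power2_eq_square sum_product mult_ac)
  also have "\<dots> = (\<Sum>p\<in>P. \<Sum>r\<in>P. \<Sum>i\<in>I. \<Sum>j\<in>I. (w i p * w i r) * (w j p * w j r))"
    by (simp only: sum.swap[of _ P I])
  also have "\<dots> = (\<Sum>p\<in>P. \<Sum>r\<in>P. (\<Sum>i\<in>I. w i p * w i r)\<^sup>2)"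
    by (simp add: power2_eq_square sum_product)
  finally show ?thesis .
qed

text \<open>All inner products of a family of vectors add up to the squared norm of their
  sum.\<close>

lemma sum_gram:
  fixes w :: "'i \<Rightarrow> 'p \<Rightarrow> 'a::comm_semiring_1"
  shows "(\<Sum>i\<in>I. \<Sum>j\<in>I. \<Sum>p\<in>P. w i p * w j p) = (\<Sum>p\<in>P. (\<Sum>i\<in>I. w i p)\<^sup>2)"
  by (simp only: sum.swap[of _ P I] power2_eq_square sum_product)

definition design_moment :: "run list \<Rightarrow> nat \<Rightarrow> nat \<Rightarrow> nat \<Rightarrow> nat \<Rightarrow> real" where
  "design_moment D a b c d = (\<Sum>i<length D. prec_sgn (D ! i) a b * prec_sgn (D ! i) c d)"

lemma sum_pair_ip_sq:
  "(\<Sum>i<length D. \<Sum>j<length D. (pair_ip m (D ! i) (D ! j))\<^sup>2)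
    = (\<Sum>a<m. \<Sum>b<m. \<Sum>c<m. \<Sum>d<m. (design_moment D a b c d)\<^sup>2)"
  using sum_gram_sq[of "\<lambda>i (a, b). prec_sgn (D ! i) a b" "{..<m} \<times> {..<m}" "{..<length D}"]
  by (simp add: pair_ip_def design_moment_def sum.cartesian_product')

lemma sum_pair_ip:
  "(\<Sum>i<length D. \<Sum>j<length D. pair_ip m (D ! i) (D ! j))
    = (\<Sum>a<m. \<Sum>b<m. (\<Sum>i<length D. prec_sgn (D ! i) a b)\<^sup>2)"
  using sum_gram[of "\<lambda>i (a, b). prec_sgn (D ! i) a b" "{..<m} \<times> {..<m}" "{..<length D}"]
  by (simp add: pair_ip_def sum.cartesian_product')

text \<open>Vanishing first moments: the property shared by foldover designs and arrays of strength
  2, so that one formula for \<open>k_m2\<close> serves both.\<close>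

definition balanced :: "nat \<Rightarrow> run list \<Rightarrow> bool" where
  "balanced m D \<longleftrightarrow> (\<forall>a<m. \<forall>b<m. (\<Sum>i<length D. prec_sgn (D ! i) a b) = 0)"

lemma nth_design: "set D \<subseteq> runs m \<Longrightarrow> i < length D \<Longrightarrow> D ! i \<in> runs m"
  using nth_mem by blast

lemma sum_index_pairs:
  fixes f :: "nat \<Rightarrow> nat \<Rightarrow> real"
  assumes "\<And>i j. f i j = f j i" "\<And>i. f i i = 0"
  shows "(\<Sum>(i, j)\<in>index_pairs D. f i j) = (\<Sum>i<length D. \<Sum>j<length D. f i j) / 2"
  using sum_pairs_symmetric[of f "length D"] assms
  by (simp add: index_pairs_def comp_pairs_def)

lemma k_ave_conv:
  "k_ave m D = (\<Sum>i<length D. \<Sum>j<length D. real (kendall_tau m (D ! i) (D ! j)))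
    / (real (length D) * (real (length D) - 1))"
  unfolding k_ave_def
  by (subst sum_index_pairs) (simp_all add: kendall_tau_commute kendall_tau_self real_choose_two)

lemma k_m2_conv:
  "k_m2 m D = (\<Sum>i<length D. \<Sum>j<length D. (real (kendall_tau m (D ! i) (D ! j)))\<^sup>2)
    / (real (length D) * (real (length D) - 1))"
  unfolding k_m2_def
  by (subst sum_index_pairs) (simp_all add: kendall_tau_commute kendall_tau_self real_choose_two)

lemma kendall_tau_pair_ip:
  assumes "x \<in> runs m" "y \<in> runs m"
  shows "real (kendall_tau m x y) = (real m * (real m - 1) - pair_ip m x y) / 4"
  using pair_ip_kendall_tau[OF assms] by simp

text \<open>Balance makes the inner products sum to zero, so only the constant part of the distances
  survives.\<close>

lemma k_ave_balanced:
  assumes "set D \<subseteq> runs m" "balanced m D" "length D > 1"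
  shows "k_ave m D = real (length D) * real m * (real m - 1) / (4 * (real (length D) - 1))"
proof -
  have "(\<Sum>i<length D. \<Sum>j<length D. real (kendall_tau m (D ! i) (D ! j)))
      = (\<Sum>i<length D. \<Sum>j<length D. (real m * (real m - 1) - pair_ip m (D ! i) (D ! j)) / 4)"
    using nth_design[OF assms(1)] by (simp add: kendall_tau_pair_ip)
  also have "\<dots> = (real (length D))\<^sup>2 * (real m * (real m - 1)) / 4"
    using assms(2) sum_pair_ip[of m D]
    by (simp add: sum_subtractf balanced_def power2_eq_square flip: sum_divide_distrib)
  finally have "k_ave m D = (real (length D))\<^sup>2 * (real m * (real m - 1)) / 4
      / (real (length D) * (real (length D) - 1))"
    by (simp only: k_ave_conv)
  then show ?thesis
    using assms(3) by (simp add: divide_simps power2_eq_square)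
qed

text \<open>Squaring k = (m(m-1) - ip)/4, with ip the inner product, gives a cross term that
  vanishes by balance and squares of ip that sum to the squared second moments.\<close>

lemma k_m2_balanced:
  assumes "set D \<subseteq> runs m" "balanced m D"
  shows "k_m2 m D = ((real (length D))\<^sup>2 * (real m * (real m - 1))\<^sup>2
      + (\<Sum>a<m. \<Sum>b<m. \<Sum>c<m. \<Sum>d<m. (design_moment D a b c d)\<^sup>2))
    / (16 * (real (length D) * (real (length D) - 1)))"
proof -
  let ?M = "real m * (real m - 1)"
  have "(\<Sum>i<length D. \<Sum>j<length D. (real (kendall_tau m (D ! i) (D ! j)))\<^sup>2)
      = (\<Sum>i<length D. \<Sum>j<length D. (?M\<^sup>2 - 2 * ?M * pair_ip m (D ! i) (D ! j)
          + (pair_ip m (D ! i) (D ! j))\<^sup>2) / 16)"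
    using nth_design[OF assms(1)]
    by (intro sum.cong refl)
      (simp add: kendall_tau_pair_ip power_divide power2_diff[of ?M])
  also have "\<dots> = ((real (length D))\<^sup>2 * ?M\<^sup>2
      - 2 * ?M * (\<Sum>i<length D. \<Sum>j<length D. pair_ip m (D ! i) (D ! j))
      + (\<Sum>i<length D. \<Sum>j<length D. (pair_ip m (D ! i) (D ! j))\<^sup>2)) / 16"
    by (simp only: sum.distrib sum_subtractf sum_divide_distrib[symmetric] sum_distrib_left[symmetric])
      (simp add: power2_eq_square)
  also have "(\<Sum>i<length D. \<Sum>j<length D. pair_ip m (D ! i) (D ! j)) = 0"
    using assms(2) by (simp add: sum_pair_ip balanced_def)
  finally show ?thesis
    by (simp only: k_m2_conv sum_pair_ip_sq divide_divide_eq_left mult_zero_right diff_zero)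
qed

text \<open>With c = \<open>oa_const m\<close> and n runs, the cross term contributes -2 n^2 c,
  since every run contributes c to it, and the squares of \<open>oa_corr\<close> contribute n^2
  c.\<close>

lemma sum_moment_deviation:
  assumes "set D \<subseteq> runs m"
  shows "(\<Sum>a<m. \<Sum>b<m. \<Sum>c<m. \<Sum>d<m.
      (design_moment D a b c d - real (length D) * oa_corr a b c d)\<^sup>2)
    = (\<Sum>a<m. \<Sum>b<m. \<Sum>c<m. \<Sum>d<m. (design_moment D a b c d)\<^sup>2)
      - (real (length D))\<^sup>2 * oa_const m"
proof -
  let ?n = "real (length D)"
  have "(\<Sum>a<m. \<Sum>b<m. \<Sum>c<m. \<Sum>d<m. oa_corr a b c d * design_moment D a b c d)
      = (\<Sum>i<length D. \<Sum>a<m. \<Sum>b<m. \<Sum>c<m. \<Sum>d<m.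
          oa_corr a b c d * (prec_sgn (D ! i) a b * prec_sgn (D ! i) c d))"
    unfolding design_moment_def sum_distrib_left by (simp only: sum.swap[of _ _ "{..<length D}"])
  also have "\<dots> = ?n * oa_const m"
    using nth_design[OF assms] by (simp add: sum_oa_corr_run)
  finally have cross: "(\<Sum>a<m. \<Sum>b<m. \<Sum>c<m. \<Sum>d<m.
      oa_corr a b c d * design_moment D a b c d) = ?n * oa_const m" .
  have "(\<Sum>a<m. \<Sum>b<m. \<Sum>c<m. \<Sum>d<m.
      (design_moment D a b c d - ?n * oa_corr a b c d)\<^sup>2)
    = (\<Sum>a<m. \<Sum>b<m. \<Sum>c<m. \<Sum>d<m. (design_moment D a b c d)\<^sup>2
        - (2 * ?n) * (oa_corr a b c d * design_moment D a b c d)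
        + ?n\<^sup>2 * (oa_corr a b c d)\<^sup>2)"
    by (intro sum.cong refl) (simp add: power2_eq_square algebra_simps)
  also have "\<dots> = (\<Sum>a<m. \<Sum>b<m. \<Sum>c<m. \<Sum>d<m. (design_moment D a b c d)\<^sup>2)
      - (2 * ?n) * (?n * oa_const m) + ?n\<^sup>2 * oa_const m"
    by (simp only: sum.distrib sum_subtractf sum_distrib_left[symmetric] cross sum_oa_corr_sq)
  finally show ?thesis
    by (simp add: power2_eq_square algebra_simps)
qed

text \<open>This is the formula of \<open>k_m2_balanced\<close> with the squared second moments
  replaced by their least possible sum.\<close>

lemma L2_conv:
  assumes "n > 1"
  shows "L2 n m = ((real n)\<^sup>2 * (real m * (real m - 1))\<^sup>2 + (real n)\<^sup>2 * oa_const m)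
    / (16 * (real n * (real n - 1)))"
proof -
  have "(real n)\<^sup>2 * (real m * (real m - 1))\<^sup>2 + (real n)\<^sup>2 * oa_const m
      = real n * (real n * real m * (real m - 1) * (9 * (real m)\<^sup>2 - 5 * real m + 10) / 9)"
    by (simp add: oa_const_def power2_eq_square algebra_simps add_divide_distrib diff_divide_distrib)
  moreover have "real n * y / (144 * (real n - 1)) = real n * (real n * y / 9) / (16 * (real n * (real n - 1)))"
    for y
    using assms by (simp add: field_simps)
  ultimately show ?thesis by (simp only: L2_def mult.assoc)
qed

lemma L2_le_k_m2:
  assumes "set D \<subseteq> runs m" "balanced m D" "length D > 1"
  shows "L2 (length D) m \<le> k_m2 m D"
proof -
  have "0 \<le> (\<Sum>a<m. \<Sum>b<m. \<Sum>c<m. \<Sum>d<m.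
      (design_moment D a b c d - real (length D) * oa_corr a b c d)\<^sup>2)"
    by (intro sum_nonneg) simp
  then show ?thesis
    using assms(3)
    by (auto simp: sum_moment_deviation[OF assms(1)] k_m2_balanced[OF assms(1,2)] L2_conv[OF assms(3)]
        intro!: divide_right_mono)
qed

section \<open>Arrays of strength two\<close>

lemma sum_mset_conv_count:
  fixes f :: "'a \<Rightarrow> 'b::comm_semiring_1"
  assumes "finite S" "set_mset N \<subseteq> S"
  shows "(\<Sum>v\<in>#N. f v) = (\<Sum>v\<in>S. of_nat (count N v) * f v)"
  using assms(2)
proof (induction N)
  case empty
  show ?case by simp
next
  case (add x N)
  have "(\<Sum>v\<in>S. of_nat (count (add_mset x N) v) * f v)
      = (\<Sum>v\<in>S. (if v = x then f v else 0) + of_nat (count N v) * f v)"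
    by (intro sum.cong) (auto simp: distrib_right)
  also have "\<dots> = f x + (\<Sum>v\<in>S. of_nat (count N v) * f v)"
    using assms(1) add.prems by (simp add: sum.distrib)
  finally show ?case using add by simp
qed

text \<open>Proportional frequencies mean that every function of the codes on \<open>W\<close> has
  the same average over the array as over the full design.\<close>

lemma sum_oa_transfer:
  fixes g :: "(nat \<times> nat \<Rightarrow> int) \<Rightarrow> real"
  assumes "oofa_oa n m t D" "W \<subseteq> comp_pairs m" "card W \<le> t"
  shows "(\<Sum>i<n. g (restrict (pwo (D ! i)) W))
    = real n / real (card (runs m)) * (\<Sum>x\<in>runs m. g (restrict (pwo x) W))"
proof -
  let ?r = "\<lambda>x. restrict (pwo x) W"
  define A where "A = image_mset ?r (mset D)"
  define B where "B = image_mset ?r (full_design m)"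
  obtain c :: real where c: "c > 0" and freq: "\<And>v. real (count A v) = c * real (count B v)"
    using assms unfolding oofa_oa_def pwo_freq_def A_def B_def by blast
  \<comment> \<open>Both sums are written over a common finite support, where the counts compare
    term by term.\<close>
  have transfer: "(\<Sum>v\<in>#A. f v) = c * (\<Sum>v\<in>#B. f v)" for f :: "(nat \<times> nat \<Rightarrow> int) \<Rightarrow> real"
    using sum_mset_conv_count[of "set_mset A \<union> set_mset B" A f]
      sum_mset_conv_count[of "set_mset A \<union> set_mset B" B f]
    by (simp add: freq sum_distrib_left mult.assoc)
  have A: "(\<Sum>v\<in>#A. f v) = (\<Sum>i<n. f (?r (D ! i)))" for f :: "(nat \<times> nat \<Rightarrow> int) \<Rightarrow> real"
  proof -
    have "(\<Sum>v\<in>#A. f v) = sum_list (map (\<lambda>x. f (?r x)) D)"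
      by (simp add: A_def image_mset.compositionality comp_def sum_mset_sum_list flip: mset_map)
    then show ?thesis
      using assms(1) by (simp add: sum_list_sum_nth oofa_oa_def atLeast0LessThan)
  qed
  have B: "(\<Sum>v\<in>#B. f v) = (\<Sum>x\<in>runs m. f (?r x))" for f :: "(nat \<times> nat \<Rightarrow> int) \<Rightarrow> real"
    by (simp add: B_def full_design_def image_mset.compositionality comp_def sum_unfold_sum_mset)
  \<comment> \<open>The constant function 1 counts runs on both sides and so fixes the
    factor.\<close>
  have "c = real n / real (card (runs m))"
    using transfer[of "\<lambda>_. 1"] card_runs_pos[of m] by (simp only: A B) (auto simp: field_simps)
  then show ?thesis
    using transfer[of g] by (simp only: A B)
qed

lemma design_moment_swap:
  "design_moment D b a c d = - design_moment D a b c d"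
  "design_moment D a b d c = - design_moment D a b c d"
  by (simp_all add: design_moment_def prec_sgn_swap[of _ b a] prec_sgn_swap[of _ d c] sum_negf)

lemma oofa_oaD:
  assumes "oofa_oa n m t D"
  shows "length D = n" "set D \<subseteq> runs m" "i < n \<Longrightarrow> D ! i \<in> runs m"
  using assms nth_design[of D m i] by (auto simp: oofa_oa_def)

lemma balanced_oofa_oa:
  assumes "oofa_oa n m 2 D"
  shows "balanced m D"
proof -
  have pos: "(\<Sum>i<n. prec_sgn (D ! i) a b) = 0" if "a < b" "b < m" for a b
  proof -
    have "(\<Sum>i<n. real_of_int (restrict (pwo (D ! i)) {(a, b)} (a, b)))
        = real n / real (card (runs m))
          * (\<Sum>x\<in>runs m. real_of_int (restrict (pwo x) {(a, b)} (a, b)))"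
      by (rule sum_oa_transfer[OF assms]) (use that in \<open>auto simp: comp_pairs_def\<close>)
    then show ?thesis
      using that oofa_oaD(3)[OF assms] sum_prec_sgn_full[of a m b]
      by (simp add: prec_sgn_pwo[of _ m])
  qed
  have "(\<Sum>i<n. prec_sgn (D ! i) a b) = 0" if "a < m" "b < m" for a b
    using pos[of a b] pos[of b a] that
    by (cases a b rule: linorder_cases) (simp_all add: prec_sgn_swap[of _ a b] sum_negf)
  then show ?thesis by (simp add: balanced_def oofa_oaD(1)[OF assms])
qed

text \<open>The product of two signs depends on at most two codes, so strength 2 transfers its
  average from the full design.\<close>

lemma design_moment_oofa_oa:
  assumes "oofa_oa n m 2 D" "a < m" "b < m" "c < m" "d < m"
  shows "design_moment D a b c d = real n * oa_corr a b c d"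
proof -
  have ordered: "design_moment D a b c d = real n * oa_corr a b c d"
    if "a < b" "b < m" "c < d" "d < m" for a b c d
  proof -
    \<comment> \<open>The two pairs may coincide; \<open>?W\<close> is then a singleton, still
      within the strength.\<close>
    let ?W = "{(a, b), (c, d)}"
    let ?g = "\<lambda>v. real_of_int (v (a, b)) * real_of_int (v (c, d))"
    have "(\<Sum>i<n. ?g (restrict (pwo (D ! i)) ?W))
        = real n / real (card (runs m)) * (\<Sum>x\<in>runs m. ?g (restrict (pwo x) ?W))"
      by (rule sum_oa_transfer[OF assms(1)]) (use that in \<open>auto simp: comp_pairs_def card_insert_if\<close>)
    then have "design_moment D a b c d = real n / real (card (runs m)) * full_moment m a b c d"
      using that oofa_oaD(1,3)[OF assms(1)]
      by (simp add: design_moment_def full_moment_def prec_sgn_pwo[of _ m])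
    then show ?thesis
      using that card_runs_pos[of m] by (auto simp: full_moment_eq)
  qed
  \<comment> \<open>Codes are indexed by pairs with \<open>a < b\<close>. Antisymmetry of both sides
    extends the identity to the remaining orders, first in the second pair and then in the
    first.\<close>
  have sorted: "design_moment D a b c d = real n * oa_corr a b c d"
    if "a < b" "b < m" "c < m" "d < m" for a b c d
  proof (cases c d rule: linorder_cases)
    case greater
    then show ?thesis
      using ordered[of a b d c] design_moment_swap(2)[of D a b d c] oa_corr_swap(2)[of a b d c] that
      by simp
  next
    case equal
    then show ?thesis by (simp add: oa_corr_degenerate design_moment_def)
  qed (use that in \<open>simp add: ordered\<close>)
  show ?thesis
  proof (cases a b rule: linorder_cases)
    case greater
    then show ?thesis
      using sorted[of b a c d] design_moment_swap(1)[of D b a c d] oa_corr_swap(1)[of b a c d] assms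
      by simp
  next
    case equal
    then show ?thesis by (simp add: oa_corr_degenerate design_moment_def)
  qed (use assms in \<open>simp add: sorted\<close>)
qed

text \<open>All deviations in \<open>sum_moment_deviation\<close> are zero, so the squared second
  moments attain their least sum.\<close>

lemma k_m2_oofa_oa:
  assumes "oofa_oa n m 2 D" "n > 1"
  shows "k_m2 m D = L2 n m"
  using sum_moment_deviation[OF oofa_oaD(2)[OF assms(1)]] assms(2)
    k_m2_balanced[OF oofa_oaD(2)[OF assms(1)] balanced_oofa_oa[OF assms(1)]]
  by (simp add: oofa_oaD(1)[OF assms(1)] design_moment_oofa_oa[OF assms(1)] L2_conv)

subsection \<open>Foldover designs\<close>

lemma length_foldover_design [simp]: "length (foldover_design H) = 2 * length H"
  by (simp add: foldover_design_def)

lemma nth_foldover_design: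
  "i < length H \<Longrightarrow> foldover_design H ! i = H ! i"
  "i < length H \<Longrightarrow> foldover_design H ! (length H + i) = foldover (H ! i)"
  by (simp_all add: foldover_design_def nth_append)

lemma set_foldover_design:
  "set H \<subseteq> runs m \<Longrightarrow> set (foldover_design H) \<subseteq> runs m"
  by (auto simp: foldover_design_def foldover_run)

lemma sum_foldover_design:
  fixes f :: "run \<Rightarrow> 'a::comm_monoid_add"
  shows "(\<Sum>i<2 * length H. f (foldover_design H ! i))
    = (\<Sum>i<length H. f (H ! i) + f (foldover (H ! i)))"
proof -
  have "(\<Sum>i<h + k. g i) = (\<Sum>i<h. g i) + (\<Sum>i<k. g (h + i))" for h k and g :: "nat \<Rightarrow> 'a"
    by (induction k) (simp_all add: add_ac)
  from this[of "\<lambda>i. f (foldover_design H ! i)" "length H" "length H"] show ?thesis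
    by (simp add: nth_foldover_design sum.distrib mult_2)
qed

text \<open>The signs of each run cancel against those of its foldover.\<close>

lemma balanced_foldover_design:
  assumes "set H \<subseteq> runs m"
  shows "balanced m (foldover_design H)"
  using nth_design[OF assms] sum_foldover_design[of "\<lambda>x. prec_sgn x a b" H for a b]
  by (simp add: balanced_def prec_sgn_foldover[of _ m])

text \<open>Reversal is injective, so a repetition lies within \<open>H\<close> or between the two
  halves. The indices may be equal: a run with a single component is its own foldover.\<close>

lemma distinct_foldover_design:
  "distinct (foldover_design H) \<longleftrightarrow>
    distinct H \<and> \<not> (\<exists>i<length H. \<exists>j<length H. H ! j = foldover (H ! i))"
proof -
  have "inj_on foldover (set H)" by (auto simp: foldover_def inj_on_def)
  moreover have "set H \<inter> foldover ` set H = {}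
      \<longleftrightarrow> \<not> (\<exists>i<length H. \<exists>j<length H. H ! j = foldover (H ! i))"
    unfolding set_conv_nth by (auto simp: disjoint_iff)
  ultimately show ?thesis by (simp add: foldover_design_def distinct_map)
qed

text \<open>Makes precise that the distances of a foldover design are a function of the distance
  matrix of its first half: halves with equal matrices have foldover designs with equal
  matrices.\<close>

lemma kendall_tau_foldover_design_cong:
  assumes "set H \<subseteq> runs m" "set H' \<subseteq> runs m" "length H' = length H"
    and dist: "\<And>i j. i < length H \<Longrightarrow> j < length H
      \<Longrightarrow> kendall_tau m (H' ! i) (H' ! j) = kendall_tau m (H ! i) (H ! j)"
    and ij: "i < 2 * length H" "j < 2 * length H"
  shows "kendall_tau m (foldover_design H' ! i) (foldover_design H' ! j)
    = kendall_tau m (foldover_design H ! i) (foldover_design H ! j)"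
proof -
  let ?h = "length H"
  have runs: "H ! i \<in> runs m" "H' ! i \<in> runs m" if "i < ?h" for i
    using nth_design assms(1-3) that by auto
  have one: "kendall_tau m (H' ! i) (foldover (H' ! j)) = kendall_tau m (H ! i) (foldover (H ! j))"
    if "i < ?h" "j < ?h" for i j
    using kendall_tau_foldover[OF runs(1)[OF that(1)] runs(1)[OF that(2)]]
      kendall_tau_foldover[OF runs(2)[OF that(1)] runs(2)[OF that(2)]] dist[OF that] by simp
  have half: "i < ?h \<or> (\<exists>k<?h. i = ?h + k)" if "i < 2 * ?h" for i
    using that by presburger
  have nth': "k < ?h \<Longrightarrow> foldover_design H' ! k = H' ! k"
    "k < ?h \<Longrightarrow> foldover_design H' ! (?h + k) = foldover (H' ! k)" for k
    using nth_foldover_design[of k H'] assms(3) by simp_all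
  have comm: "kendall_tau m (foldover x) y = kendall_tau m y (foldover x)" for x y
    by (rule kendall_tau_commute)
  from half[OF ij(1)] half[OF ij(2)] show ?thesis
    by (elim disjE exE conjE)
      (simp_all add: nth_foldover_design nth' dist one kendall_tau_foldover_both runs, simp add: comm one)
qed

section \<open>Minimum distance and upper bound for the mean square\<close>

lemma finite_index_pairs [simp]: "finite (index_pairs D)"
  by (rule finite_subset[of _ "{..<length D} \<times> {..<length D}"]) (auto simp: index_pairs_def)

lemma k_min_le: "i < j \<Longrightarrow> j < length D \<Longrightarrow> k_min m D \<le> kendall_tau m (D ! i) (D ! j)"
  unfolding k_min_def
  by (rule Min_le[OF finite_imageI[OF finite_index_pairs]])
    (auto simp: index_pairs_def intro!: image_eqI[of _ _ "(i, j)"])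

lemma k_min_pos:
  assumes "set D \<subseteq> runs m" "distinct D" "length D > 1"
  shows "1 \<le> k_min m D"
proof -
  \<comment> \<open>This makes the set under \<open>Min\<close> nonempty.\<close>
  have "(0, 1) \<in> index_pairs D" using assms(3) by (simp add: index_pairs_def)
  moreover have "kendall_tau m (D ! i) (D ! j) \<noteq> 0" if "i < j" "j < length D" for i j
    using kendall_tau_eq_0D[of "D ! i" m "D ! j"] that nth_design[OF assms(1)] assms(2)
    by (auto simp: nth_eq_iff_index_eq)
  ultimately show ?thesis
    unfolding k_min_def
    by (subst Min_ge_iff[OF finite_imageI[OF finite_index_pairs]]) (auto simp: index_pairs_def Suc_le_eq)
qed

text \<open>The distances from the first run to the second and to the foldover of the second add up
  to m(m-1)/2, so the smaller is at most half of that.\<close>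

lemma k_min_foldover_design_le:
  assumes "set H \<subseteq> runs m" "length H \<ge> 2"
  shows "int (k_min m (foldover_design H)) \<le> \<lfloor>real m * (real m - 1) / 4\<rfloor>"
proof -
  let ?D = "foldover_design H" and ?h = "length H"
  have len: "0 < ?h" "1 < ?h" using assms(2) by auto
  have "k_min m ?D \<le> kendall_tau m (H ! 0) (H ! 1)"
    using k_min_le[of 0 1 ?D m] len nth_foldover_design(1)[OF len(1)] nth_foldover_design(1)[OF len(2)]
    by simp
  moreover have "k_min m ?D \<le> kendall_tau m (H ! 0) (foldover (H ! 1))"
    using k_min_le[of 0 "?h + 1" ?D m] len nth_foldover_design(1)[OF len(1)]
      nth_foldover_design(2)[OF len(2)]
    by simp
  moreover have "real (kendall_tau m (H ! 0) (foldover (H ! 1)))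
      = real m * (real m - 1) / 2 - real (kendall_tau m (H ! 0) (H ! 1))"
    using kendall_tau_foldover[of "H ! 0" m "H ! 1"] nth_design[OF assms(1)] len
    by (simp add: real_choose_two)
  ultimately show ?thesis by (simp add: le_floor_iff)
qed

text \<open>The distance matrix has four blocks: the two diagonal ones have entries k, the other two
  q - k, where q = \<open>m choose 2\<close>.\<close>

lemma sum_kendall_tau_sq_foldover_design:
  assumes "set H \<subseteq> runs m"
  shows "(\<Sum>i<2 * length H. \<Sum>j<2 * length H.
      (real (kendall_tau m (foldover_design H ! i) (foldover_design H ! j)))\<^sup>2)
    = (\<Sum>i<length H. \<Sum>j<length H. 2 * ((real (kendall_tau m (H ! i) (H ! j)))\<^sup>2
        + (real (m choose 2) - real (kendall_tau m (H ! i) (H ! j)))\<^sup>2))"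
proof -
  have runs: "H ! i \<in> runs m" if "i < length H" for i
    using nth_design[OF assms that] .
  have comm: "kendall_tau m (foldover x) y = kendall_tau m y (foldover x)" for x y
    by (rule kendall_tau_commute)
  have "real (kendall_tau m (foldover (H ! i)) (H ! j))
      = real (m choose 2) - real (kendall_tau m (H ! i) (H ! j))" if "i < length H" "j < length H" for i j
    using kendall_tau_foldover[OF runs runs, of j i] that kendall_tau_commute[of m "H ! i" "H ! j"]
    by (simp add: comm)
  then show ?thesis
    using sum_foldover_design[of "\<lambda>y. (real (kendall_tau m x y))\<^sup>2" H for x]
      sum_foldover_design[of "\<lambda>x. \<Sum>j<2 * length H.
        (real (kendall_tau m x (foldover_design H ! j)))\<^sup>2" H]
    by (simp add: kendall_tau_foldover kendall_tau_foldover_both runs add_ac flip: sum.distrib)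
qed

lemma k_m2_foldover_design_le:
  assumes "set H \<subseteq> runs m" "length H \<ge> 2" "distinct (foldover_design H)"
  shows "k_m2 m (foldover_design H) \<le> U2 (2 * length H) m"
proof -
  let ?h = "length H" and ?q = "real (m choose 2)"
  \<comment> \<open>The \<open>of_bool\<close> term corrects the off-diagonal bound to the exact
    diagonal value \<open>2 * ?q\<^sup>2\<close>, so that one expression can be summed over all
    index pairs.\<close>
  have bound: "2 * ((real (kendall_tau m (H ! i) (H ! j)))\<^sup>2
        + (?q - real (kendall_tau m (H ! i) (H ! j)))\<^sup>2)
      \<le> 2 * (1 + (?q - 1)\<^sup>2) + of_bool (i = j) * (2 * ?q\<^sup>2 - 2 * (1 + (?q - 1)\<^sup>2))"
    if ij: "i < ?h" "j < ?h" for i j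
  proof (cases "i = j")
    case True
    then show ?thesis by (simp add: kendall_tau_self)
  next
    case False
    have runs: "H ! i \<in> runs m" "H ! j \<in> runs m" using nth_design[OF assms(1)] ij by auto
    have "H ! i \<noteq> H ! j" "H ! i \<noteq> foldover (H ! j)"
      using assms(3) False ij by (auto simp: distinct_foldover_design nth_eq_iff_index_eq)
    then have "kendall_tau m (H ! i) (H ! j) \<noteq> 0" "kendall_tau m (H ! i) (foldover (H ! j)) \<noteq> 0"
      using kendall_tau_eq_0D[of "H ! i" m "H ! j"] kendall_tau_eq_0D[of "H ! i" m "foldover (H ! j)"] runs
      by (auto simp: foldover_run)
    then have "real (kendall_tau m (H ! i) (H ! j)) \<ge> 1"
      "?q - real (kendall_tau m (H ! i) (H ! j)) \<ge> 1"
      using kendall_tau_foldover[OF runs] by linarith+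
    \<comment> \<open>The gap 1 + (q-1)^2 - k^2 - (q-k)^2 factors as 2(k-1)(q-k-1).\<close>
    then have "0 \<le> (real (kendall_tau m (H ! i) (H ! j)) - 1)
        * (?q - real (kendall_tau m (H ! i) (H ! j)) - 1)"
      by simp
    then show ?thesis using False by (simp add: power2_eq_square algebra_simps)
  qed
  have "(\<Sum>i<2 * ?h. \<Sum>j<2 * ?h.
        (real (kendall_tau m (foldover_design H ! i) (foldover_design H ! j)))\<^sup>2)
      \<le> (\<Sum>i<?h. \<Sum>j<?h. 2 * (1 + (?q - 1)\<^sup>2)
          + of_bool (i = j) * (2 * ?q\<^sup>2 - 2 * (1 + (?q - 1)\<^sup>2)))"
    unfolding sum_kendall_tau_sq_foldover_design[OF assms(1)]
    by (intro sum_mono) (simp only: lessThan_iff bound)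
  also have "\<dots> = real ?h * (real ?h * (2 * (1 + (?q - 1)\<^sup>2)))
      + real ?h * (2 * ?q\<^sup>2 - 2 * (1 + (?q - 1)\<^sup>2))"
    by (simp add: sum.distrib distrib_left)
  finally have "k_m2 m (foldover_design H)
      \<le> (real ?h * (real ?h * (2 * (1 + (?q - 1)\<^sup>2)))
        + real ?h * (2 * ?q\<^sup>2 - 2 * (1 + (?q - 1)\<^sup>2)))
      / (real (2 * ?h) * (real (2 * ?h) - 1))"
    using assms(2) by (simp add: k_m2_conv divide_right_mono)
  also have "\<dots> = U2 (2 * ?h) m"
  proof -
    have "?h > 0" "2 * real ?h - 1 > 0" using assms(2) by auto
    then show ?thesis
      by (simp add: U2_def real_choose_two divide_simps) (simp add: power2_eq_square algebra_simps)
  qed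
  finally show ?thesis .
qed

theorem theorem3:
  fixes h n m q :: nat and H D :: "run list"
  assumes "h \<ge> 2" and "n = 2 * h" and "m \<ge> 1" and "q = m choose 2"
    and "length H = h" and "set H \<subseteq> runs m"
    and "D = foldover_design H"
  shows "(distinct D \<longleftrightarrow>
            distinct H \<and> \<not> (\<exists>i<h. \<exists>j<h. H ! j = foldover (H ! i)))
    \<and> (distinct D \<longrightarrow>
         \<comment> \<open>(i)\<close>
         (\<forall>i j. i < j \<and> j < h \<longrightarrow>
            kendall_tau m (foldover (H ! i)) (foldover (H ! j)) = kendall_tau m (H ! i) (H ! j))
       \<and> (\<forall>i<h. kendall_tau m (H ! i) (foldover (H ! i)) = q)
       \<and> (\<forall>i<h. \<forall>j<h. i \<noteq> j \<longrightarrow>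
            int (kendall_tau m (H ! i) (foldover (H ! j)))
              = int q - int (kendall_tau m (H ! i) (H ! j)))
       \<and> (\<forall>H'. length H' = h \<and> set H' \<subseteq> runs m
            \<and> (\<forall>i<h. \<forall>j<h. kendall_tau m (H' ! i) (H' ! j) = kendall_tau m (H ! i) (H ! j))
            \<longrightarrow> (\<forall>i<n. \<forall>j<n. kendall_tau m (foldover_design H' ! i) (foldover_design H' ! j)
                               = kendall_tau m (D ! i) (D ! j)))
         \<comment> \<open>(ii)\<close>
       \<and> k_ave m D = real n * real m * (real m - 1) / (4 * (real n - 1))
         \<comment> \<open>(iii)\<close>
       \<and> 1 \<le> k_min m D
       \<and> int (k_min m D) \<le> \<lfloor>real m * (real m - 1) / 4\<rfloor>
         \<comment> \<open>(iv)\<close>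
       \<and> L2 n m \<le> k_m2 m D
       \<and> k_m2 m D \<le> U2 n m
       \<and> (\<forall>D'. oofa_oa n m 2 D' \<longrightarrow> k_m2 m D' = L2 n m))"
proof -
  have len: "length D = n" "length D > 1" "n > 1" and D: "set D \<subseteq> runs m" "balanced m D"
    using assms set_foldover_design[of H m] balanced_foldover_design[of H m] by simp_all
  have runs: "H ! i \<in> runs m" if "i < h" for i
    using nth_design assms(5,6) that by blast
  show ?thesis
  proof (intro conjI impI allI)
    show "distinct D \<longleftrightarrow> distinct H \<and> \<not> (\<exists>i<h. \<exists>j<h. H ! j = foldover (H ! i))"
      using distinct_foldover_design[of H] assms(5,7) by simp
  next
    fix i j assume "i < j \<and> j < h"
    then show "kendall_tau m (foldover (H ! i)) (foldover (H ! j)) = kendall_tau m (H ! i) (H ! j)"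
      by (simp add: kendall_tau_foldover_both runs)
  next
    fix i assume "i < h"
    then show "kendall_tau m (H ! i) (foldover (H ! i)) = q"
      using kendall_tau_foldover[OF runs runs, of i i] assms(4) by (simp add: kendall_tau_self)
  next
    fix i j assume "i < h" "j < h"
    then show "int (kendall_tau m (H ! i) (foldover (H ! j)))
        = int q - int (kendall_tau m (H ! i) (H ! j))"
      using kendall_tau_foldover[OF runs runs, of i j] assms(4) by linarith
  next
    fix H' i j
    assume "length H' = h \<and> set H' \<subseteq> runs m
      \<and> (\<forall>i<h. \<forall>j<h. kendall_tau m (H' ! i) (H' ! j) = kendall_tau m (H ! i) (H ! j))"
      and "i < n" "j < n"
    then show "kendall_tau m (foldover_design H' ! i) (foldover_design H' ! j)
        = kendall_tau m (D ! i) (D ! j)"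
      unfolding assms(7) using assms(2,5,6) by (intro kendall_tau_foldover_design_cong) simp_all
  next
    show "k_ave m D = real n * real m * (real m - 1) / (4 * (real n - 1))"
      using k_ave_balanced[OF D len(2)] len(1) by simp
    show "L2 n m \<le> k_m2 m D"
      using L2_le_k_m2[OF D len(2)] len(1) by simp
  next
    assume "distinct D"
    then show "1 \<le> k_min m D" "k_m2 m D \<le> U2 n m"
      using k_min_pos[OF D(1)] len(2) k_m2_foldover_design_le[of H m] assms by simp_all
  next
    show "int (k_min m D) \<le> \<lfloor>real m * (real m - 1) / 4\<rfloor>"
      using k_min_foldover_design_le[of H m] assms by simp
  next
    fix D' assume "oofa_oa n m 2 D'"
    then show "k_m2 m D' = L2 n m" using len(3) by (rule k_m2_oofa_oa)
  qed
qed

end
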